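(* Let $n\in\mathbb{N}$ be the number of receivers and let $\mathbf{c}^0=(c_1^0,\ldots,c_n^0)$ be the vector of numbers of successes required by the receivers. For an integer vector $\mathbf{c}\le\mathbf{c}^0$ (componentwise), interpreted as the vector of numbers of successes left to go, let $N(\mathbf{c})=\{j: c_j>0\}$ be the set of active receivers, and let $\mathbf{1}_S\in\{0,1\}^n$ be the indicator vector of $S$. Sums below are over all subsets $S$, including the empty set. (State-dependent receptions, heterogeneous receivers.) Let $q_{j,k}=(1-d^{\,k-1-c})q_j$ for $1\le j\le n$, $1\le k\le c$, with $d$ finite. The expectation $\mathbb{E}[Y_{n:n}^{(\mathbf{c}^0)}]$ admits the recurrence $$\mathbb{E}\bigl[Y_{n:n}^{(\mathbf{c})}\bigr]=1+\sum_{S\subseteq N(\mathbf{c})}\ \prod_{j\in S}q_{j,c_j^0-c_j+1}\prod_{j\in N(\mathbf{c})\setminus S}\bigl(1-q_{j,c_j^0-c_j+1}\bigr)\ \mathbb{E}\bigl[Y_{n:n}^{(\mathbf{c}-\mathbf{1}_S)}\bigr],$$ with boundary condition $\mathbb{E}[Y_{n:n}^{(\mathbf{0})}]=0$. (State-independent receptions, heterogeneous receivers.) Let $q_{j,k}=q_j$ for all $k$. The expectation $\mathbb{E}[Y_{n:n}^{(\mathbf{c}^0)}]$ admits the recurrence $$\mathbb{E}\bigl[Y_{n:n}^{(\mathbf{c})}\bigr]=1+\sum_{S\subseteq N(\mathbf{c})}\ \prod_{j\in S}q_j\prod_{j\in N(\mathbf{c})\setminus S}(1-q_j)\ \mathbb{E}\bigl[Y_{n:n}^{(\mathbf{c}-\mathbf{1}_S)}\bigr],$$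 again with boundary condition $\mathbb{E}[Y_{n:n}^{(\mathbf{0})}]=0$.
   Context: $\mathbb{N}=\{1,2,\ldots\}$. A transmitter broadcasts random linear combinations, over a field of size $d$, of a block of $c$ packets to $n$ receivers over independent erasure channels; $q_j\in(0,1)$ is the reception probability of receiver $j$, and $q_{j,k}$ is the probability that, in a given time slot, receiver $j$ in state $k$ (having $k-1$ linearly independent combinations) succeeds in obtaining a new linearly independent one. The state-independent case corresponds to $d=\infty$. The random variables are $Y_{n:n}^{(\mathbf{c})}=\max(Y_1^{(c_1)},\ldots,Y_n^{(c_n)})$ with $Y_j^{(c_j)}=\sum_{k=1}^{c_j}X_{j,k}$, where the $X_{j,k}\sim\mathrm{Geo}(q_{j,k})$ are independent in $j$ and $k$, and $\mathrm{Geo}(q)$ is the geometric distribution on $\{1,2,\ldots\}$ with success probability $q$. In the recurrence, $\mathbf{c}^0$ is the initial target vector (the basic case being $c_j^0=c$ for all $j$; the state indices used are those of the $n\times c$ matrix $(q_{j,k})$), and a receiver $j$ with $c_j$ successes to go is in state $k=c_j^0-c_j+1$; a success of the receivers in $S$ changes $\mathbf{c}$ to $\mathbf{c}-\mathbf{1}_S$. *)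

theory Defs
  imports "HOL-Probability.Probability"
begin

text \<open>The geometric distribution supported on \<open>{1, 2, \<dots>}\<close>; the library's
  \<^const>\<open>geometric_pmf\<close> counts failures and is supported on \<open>{0, 1, \<dots>}\<close>.\<close>

definition geo_pmf :: "real \<Rightarrow> nat pmf" where
  "geo_pmf q = map_pmf Suc (geometric_pmf q)"

lemma pmf_geo_pmf_Suc:
  assumes "q \<in> {0<..1}"
  shows "pmf (geo_pmf q) (Suc i) = (1 - q) ^ i * q"
  using assms by (simp add: geo_pmf_def pmf_map_inj')

text \<open>Receivers are indexed by \<open>{1..n}\<close>. State indices and target vectors are integers, so
  that \<open>c0 j - m j + 1\<close> and the exponent \<open>k - 1 - c\<close> are genuine subtractions.\<close>

definition indep_geometric ::
  "'a measure \<Rightarrow> (nat \<Rightarrow> int \<Rightarrow> 'a \<Rightarrow> nat) \<Rightarrow> nat \<Rightarrow> int \<Rightarrow> (nat \<Rightarrow> int \<Rightarrow> real) \<Rightarrow> bool" where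
  "indep_geometric M X n c q \<longleftrightarrow>
     prob_space.indep_vars M (\<lambda>_. count_space UNIV) (\<lambda>(j, k). X j k) ({1..n} \<times> {1..c}) \<and>
     (\<forall>j\<in>{1..n}. \<forall>k\<in>{1..c}.
        distr M (count_space UNIV) (X j k) = measure_pmf (geo_pmf (q j k)))"

text \<open>In state \<open>k\<close> the received combinations span a subspace of dimension \<open>k - 1\<close>, so a uniformly
  random vector of a \<open>c\<close>-dimensional space over a field of size \<open>d\<close> lies in it with probability
  \<open>d powi (k - 1 - c)\<close>.\<close>

definition state_dep_prob :: "nat \<Rightarrow> int \<Rightarrow> (nat \<Rightarrow> real) \<Rightarrow> nat \<Rightarrow> int \<Rightarrow> real" where
  "state_dep_prob d c q j k = (1 - real d powi (k - 1 - c)) * q j"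

definition active :: "nat \<Rightarrow> (nat \<Rightarrow> int) \<Rightarrow> nat set" where
  "active n m = {j \<in> {1..n}. m j > 0}"

text \<open>With \<open>m j\<close> successes left to go, receiver \<open>j\<close> is in state \<open>c0 j - m j + 1\<close>, so the time
  it still needs is the sum of the waiting times in the states
  \<open>c0 j - m j + 1, \<dots>, c0 j\<close>. For \<open>m = c0\<close> these are the states \<open>1, \<dots>, c0 j\<close>.\<close>

definition receiver_time ::
  "(nat \<Rightarrow> int \<Rightarrow> 'a \<Rightarrow> nat) \<Rightarrow> (nat \<Rightarrow> int) \<Rightarrow> (nat \<Rightarrow> int) \<Rightarrow> nat \<Rightarrow> 'a \<Rightarrow> nat" where
  "receiver_time X c0 m j \<omega> = (\<Sum>k=1..m j. X j (c0 j - m j + k) \<omega>)"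

definition max_time ::
  "(nat \<Rightarrow> int \<Rightarrow> 'a \<Rightarrow> nat) \<Rightarrow> nat \<Rightarrow> (nat \<Rightarrow> int) \<Rightarrow> (nat \<Rightarrow> int) \<Rightarrow> 'a \<Rightarrow> nat" where
  "max_time X n c0 m \<omega> = (MAX j\<in>{1..n}. receiver_time X c0 m j \<omega>)"

lemma max_time_initial:
  "max_time X n c0 c0 \<omega> = (MAX j\<in>{1..n}. \<Sum>k=1..c0 j. X j k \<omega>)"
  by (simp add: max_time_def receiver_time_def)

definition expected_time ::
  "'a measure \<Rightarrow> (nat \<Rightarrow> int \<Rightarrow> 'a \<Rightarrow> nat) \<Rightarrow> nat \<Rightarrow> (nat \<Rightarrow> int) \<Rightarrow> (nat \<Rightarrow> int) \<Rightarrow> real" where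
  "expected_time M X n c0 m = prob_space.expectation M (\<lambda>\<omega>. real (max_time X n c0 m \<omega>))"

end

theory Submission
  imports Defs
begin

text \<open>The expectation is the sum over \<open>t\<close> of the tails \<open>1 - G\<^sub>m t\<close>, where by independence
  \<open>G\<^sub>m t\<close> is the product of the distribution functions of the receiver times. Conditioning a
  receiver on its first slot (memorylessness of the geometric distribution) gives
  \<open>F\<^sub>m (t + 1) = q F\<^bsub>m - 1\<^esub> t + (1 - q) F\<^sub>m t\<close>. Expanding the product of these two-term sums
  over the active receivers yields \<open>G\<^sub>m (t + 1)\<close> as a convex combination, over the sets \<open>S\<close> of
  successful receivers, of \<open>G\<^bsub>m - 1\<^sub>S\<^esub> t\<close>, and summing over \<open>t\<close> gives the recurrence.\<close>

section \<open>Tail sums, convolution and geometric waiting times\<close>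

lemma (in prob_space) expectation_nat_tail_sums:
  fixes f :: "'a \<Rightarrow> nat"
  assumes [measurable]: "f \<in> measurable M (count_space UNIV)"
    and int: "integrable M (\<lambda>\<omega>. real (f \<omega>))"
  shows "(\<lambda>t. prob {\<omega>\<in>space M. t < f \<omega>}) sums expectation (\<lambda>\<omega>. real (f \<omega>))"
proof -
  have "(\<Sum>t. ennreal (prob {\<omega>\<in>space M. t < f \<omega>})) = (\<integral>\<^sup>+\<omega>. of_nat (f \<omega>) \<partial>M)"
    by (simp add: nn_integral_nat_function emeasure_eq_measure)
  also have "\<dots> = ennreal (expectation (\<lambda>\<omega>. real (f \<omega>)))"
    using nn_integral_eq_integral[OF int] by (simp add: ennreal_of_nat_eq_real_of_nat)
  finally have "(\<lambda>t. ennreal (prob {\<omega>\<in>space M. t < f \<omega>})) sums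
      ennreal (expectation (\<lambda>\<omega>. real (f \<omega>)))"
    using summableI sums_iff by blast
  \<comment> \<open>Integrability has put a real number on the right, so the series of nonnegative
    terms can be read in the reals and converges there.\<close>
  then show ?thesis
    by (subst (asm) sums_ennreal) auto
qed

text \<open>Convolution formula: the event splits disjointly according to the value of
  \<open>X\<close>, and independence factors each piece.\<close>

lemma (in prob_space) prob_add_eq_sum:
  fixes X Y :: "'a \<Rightarrow> nat"
  assumes ind: "indep_var (count_space UNIV) X (count_space UNIV) Y"
  shows "prob {\<omega>\<in>space M. X \<omega> + Y \<omega> \<le> t} =
    (\<Sum>i\<le>t. prob {\<omega>\<in>space M. X \<omega> = i} * prob {\<omega>\<in>space M. Y \<omega> \<le> t - i})"
proof -
  have [measurable]: "X \<in> measurable M (count_space UNIV)" "Y \<in> measurable M (count_space UNIV)"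
    using indep_var_rv1[OF ind] indep_var_rv2[OF ind] by auto
  have "{\<omega>\<in>space M. X \<omega> + Y \<omega> \<le> t} = (\<Union>i\<le>t. {\<omega>\<in>space M. X \<omega> = i \<and> Y \<omega> \<le> t - i})"
    by auto
  also have "prob \<dots> = (\<Sum>i\<le>t. prob {\<omega>\<in>space M. X \<omega> = i \<and> Y \<omega> \<le> t - i})"
    by (rule finite_measure_finite_Union) (auto simp: disjoint_family_on_def)
  also have "\<dots> = (\<Sum>i\<le>t. prob {\<omega>\<in>space M. X \<omega> = i} * prob {\<omega>\<in>space M. Y \<omega> \<le> t - i})"
    using prob_indep_random_variable[OF ind, of "{_}" "{.. t - _}"] by simp
  finally show ?thesis .
qed

lemma (in prob_space) prob_geo_eq:
  assumes distr: "distr M (count_space UNIV) X = measure_pmf (geo_pmf p)"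
    and [measurable]: "X \<in> measurable M (count_space UNIV)"
  shows "prob {\<omega>\<in>space M. X \<omega> = i} = pmf (geo_pmf p) i"
proof -
  have "pmf (geo_pmf p) i = measure (distr M (count_space UNIV) X) {i}"
    by (simp add: distr measure_pmf_single)
  also have "\<dots> = prob {\<omega>\<in>space M. X \<omega> = i}"
    by (subst measure_distr) (auto intro!: arg_cong[where f = prob])
  finally show ?thesis by simp
qed

lemma (in prob_space) prob_geo_add_le_0:
  fixes X Y :: "'a \<Rightarrow> nat"
  assumes ind: "indep_var (count_space UNIV) X (count_space UNIV) Y"
    and distr: "distr M (count_space UNIV) X = measure_pmf (geo_pmf p)"
  shows "prob {\<omega>\<in>space M. X \<omega> + Y \<omega> \<le> 0} = 0"
  using indep_var_rv1[OF ind]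
  by (subst prob_add_eq_sum[OF ind])
     (simp add: prob_geo_eq[OF distr] geo_pmf_def pmf_eq_0_set_pmf)

text \<open>Memorylessness with an independent summand: the first trial either succeeds, leaving
  only \<open>Y\<close>, or fails, and then \<open>X\<close> starts afresh with one slot
  less.\<close>

lemma (in prob_space) prob_geo_add_le_Suc:
  fixes X Y :: "'a \<Rightarrow> nat"
  assumes ind: "indep_var (count_space UNIV) X (count_space UNIV) Y"
    and distr: "distr M (count_space UNIV) X = measure_pmf (geo_pmf p)"
    and p: "p \<in> {0<..1}"
  shows "prob {\<omega>\<in>space M. X \<omega> + Y \<omega> \<le> Suc t} =
    p * prob {\<omega>\<in>space M. Y \<omega> \<le> t} + (1 - p) * prob {\<omega>\<in>space M. X \<omega> + Y \<omega> \<le> t}"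
proof -
  have [measurable]: "X \<in> measurable M (count_space UNIV)"
    using indep_var_rv1[OF ind] by auto
  define H where "H u = prob {\<omega>\<in>space M. Y \<omega> \<le> u}" for u
  have pmf_0: "pmf (geo_pmf p) 0 = 0"
    by (simp add: geo_pmf_def pmf_eq_0_set_pmf)
  \<comment> \<open>The term for \<open>X = 0\<close> vanishes because \<open>geo_pmf\<close> lives
    on {1, 2, ...}; shifting the index leaves the geometric weights.\<close>
  have Suc: "prob {\<omega>\<in>space M. X \<omega> + Y \<omega> \<le> Suc t} = (\<Sum>i\<le>t. (1 - p) ^ i * p * H (t - i))" for t
    by (subst prob_add_eq_sum[OF ind], subst sum.atMost_Suc_shift)
       (simp add: prob_geo_eq[OF distr] pmf_0 pmf_geo_pmf_Suc[OF p] H_def)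
  show ?thesis
  \<comment> \<open>The formula \<open>Suc\<close> covers positive bounds only, so the probability
    on the right is treated separately at bound 0. For positive \<open>t\<close>, the term
    \<open>i = 0\<close> is the success part and the remaining terms share the factor
    \<open>1 - p\<close>.\<close>
  proof (cases t)
    case 0
    then show ?thesis
      using Suc[of 0] prob_geo_add_le_0[OF ind distr] by (simp add: H_def)
  next
    case (Suc s)
    show ?thesis
      unfolding \<open>t = Suc s\<close> \<open>\<And>t. prob {\<omega>\<in>space M. X \<omega> + Y \<omega> \<le> Suc t} = _\<close>
      by (subst sum.atMost_Suc_shift) (simp add: sum_distrib_left mult_ac H_def)
  qed
qed

lemma (in prob_space) integrable_geo:
  assumes distr: "distr M (count_space UNIV) X = measure_pmf (geo_pmf p)"
    and [measurable]: "X \<in> measurable M (count_space UNIV)"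
    and p: "p \<in> {0<..1}"
  shows "integrable M (\<lambda>\<omega>. real (X \<omega>))"
proof -
  have "integrable (geometric_pmf p) (\<lambda>x. 1 + real x)"
    using integrable_real_geometric_pmf[OF p] by (intro Bochner_Integration.integrable_add) auto
  then have "integrable (distr M (count_space UNIV) X) real"
    unfolding distr geo_pmf_def by (simp add: algebra_simps)
  then show ?thesis
    by (simp add: integrable_distr_eq)
qed

lemma (in prob_space) indep_var_sum_nat:
  fixes X :: "'i \<Rightarrow> 'a \<Rightarrow> nat"
  assumes "finite I" "i \<notin> I"
    and ind: "indep_vars (\<lambda>_. count_space UNIV) X (insert i I)"
  shows "indep_var (count_space UNIV) (X i) (count_space UNIV) (\<lambda>\<omega>. \<Sum>i\<in>I. X i \<omega>)"
proof -
  \<comment> \<open>The sum is formed over the reals, and composing both variables with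
    \<open>nat\<close> of the floor undoes the cast.\<close>
  have "indep_vars (\<lambda>_. borel) (\<lambda>i \<omega>. real (X i \<omega>)) (insert i I)"
    by (rule indep_vars_compose2[OF ind]) auto
  then have "indep_var borel (\<lambda>\<omega>. real (X i \<omega>)) borel (\<lambda>\<omega>. \<Sum>i\<in>I. real (X i \<omega>))"
    by (rule indep_vars_sum[OF assms(1,2)])
  then have "indep_var (count_space UNIV) ((\<lambda>x. nat \<lfloor>x\<rfloor>) \<circ> (\<lambda>\<omega>. real (X i \<omega>)))
      (count_space UNIV) ((\<lambda>x. nat \<lfloor>x\<rfloor>) \<circ> (\<lambda>\<omega>. \<Sum>i\<in>I. real (X i \<omega>)))"
    by (rule indep_var_compose) measurable
  then show ?thesis
    by (simp add: comp_def flip: of_nat_sum)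
qed

section \<open>Receiver times as sums over the remaining states\<close>

lemma receiver_time_eq_sum:
  "receiver_time X c0 m j \<omega> = (\<Sum>k\<in>{c0 j - m j<..c0 j}. X j k \<omega>)"
  unfolding receiver_time_def
  by (rule sum.reindex_bij_witness[of _ "\<lambda>k. k - (c0 j - m j)" "\<lambda>k. c0 j - m j + k"]) auto

text \<open>The abstract probabilities \<open>p\<close> let both reception models be treated at
  once. Together with \<open>m j \<le> c0 j\<close>, the bound \<open>c0_le\<close> keeps every
  state that occurs inside \<open>{1..c}\<close>, where \<open>geo\<close> fixes the distributions.
  Entries of \<open>m\<close> may be negative; the range of states is then empty.\<close>

locale receivers = prob_space M for M :: "'a measure" +
  fixes X :: "nat \<Rightarrow> int \<Rightarrow> 'a \<Rightarrow> nat" and n :: nat and c :: int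
    and c0 :: "nat \<Rightarrow> int" and p :: "nat \<Rightarrow> int \<Rightarrow> real"
  assumes n_pos: "1 \<le> n"
    and c0_le: "j \<in> {1..n} \<Longrightarrow> c0 j \<le> c"
    and p_range: "j \<in> {1..n} \<Longrightarrow> k \<in> {1..c} \<Longrightarrow> p j k \<in> {0<..1}"
    and geo: "indep_geometric M X n c p"
begin

abbreviation T :: "(nat \<Rightarrow> int) \<Rightarrow> nat \<Rightarrow> 'a \<Rightarrow> nat" where
  "T \<equiv> receiver_time X c0"

abbreviation admissible :: "(nat \<Rightarrow> int) \<Rightarrow> bool" where
  "admissible m \<equiv> \<forall>j\<in>{1..n}. m j \<le> c0 j"

lemma indep_X: "indep_vars (\<lambda>_. count_space UNIV) (\<lambda>(j, k). X j k) ({1..n} \<times> {1..c})"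
  using geo by (simp add: indep_geometric_def)

lemma distr_X:
  "j \<in> {1..n} \<Longrightarrow> k \<in> {1..c} \<Longrightarrow> distr M (count_space UNIV) (X j k) = measure_pmf (geo_pmf (p j k))"
  using geo by (simp add: indep_geometric_def)

lemma measurable_X: "j \<in> {1..n} \<Longrightarrow> k \<in> {1..c} \<Longrightarrow> X j k \<in> measurable M (count_space UNIV)"
  using indep_X by (force simp: indep_vars_def)

lemma states_subset: "admissible m \<Longrightarrow> j \<in> {1..n} \<Longrightarrow> {c0 j - m j<..c0 j} \<subseteq> {1..c}"
  using c0_le[of j] by force

lemma integrable_T:
  assumes "admissible m" "j \<in> {1..n}"
  shows "integrable M (\<lambda>\<omega>. real (T m j \<omega>))"
  unfolding receiver_time_eq_sum of_nat_sum
  using states_subset[OF assms] assms(2)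
  by (intro Bochner_Integration.integrable_sum integrable_geo[OF distr_X measurable_X p_range]) auto

lemma indep_T:
  assumes "admissible m"
  shows "indep_vars (\<lambda>_. count_space UNIV) (T m) {1..n}"
proof -
  \<comment> \<open>The states used by receiver \<open>j\<close> form one block of index pairs.
    Blocks of different receivers are disjoint, so functions of separate blocks are
    independent.\<close>
  let ?K = "\<lambda>j. {j} \<times> {c0 j - m j<..c0 j}"
  have "indep_vars (\<lambda>_. borel) (\<lambda>(j, k) \<omega>. real (X j k \<omega>)) ({1..n} \<times> {1..c})"
    using indep_vars_compose2[OF indep_X, of "\<lambda>_. real" "\<lambda>_. borel"] by (simp add: case_prod_beta')
  then have "indep_vars (\<lambda>j. PiM (?K j) (\<lambda>_. borel))
      (\<lambda>j \<omega>. restrict (\<lambda>i. (case i of (j, k) \<Rightarrow> \<lambda>\<omega>. real (X j k \<omega>)) \<omega>) (?K j)) {1..n}"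
    by (rule indep_vars_restrict)
       (use states_subset[OF assms] in \<open>auto simp: disjoint_family_on_def\<close>)
  then have "indep_vars (\<lambda>_. count_space UNIV)
     (\<lambda>j \<omega>. nat \<lfloor>\<Sum>i\<in>?K j. restrict (\<lambda>i. (case i of (j, k) \<Rightarrow> \<lambda>\<omega>. real (X j k \<omega>)) \<omega>) (?K j) i\<rfloor>) {1..n}"
    by (rule indep_vars_compose2[where Y = "\<lambda>j f. nat \<lfloor>\<Sum>i\<in>?K j. f i\<rfloor>"]) measurable
  also have "(\<lambda>j \<omega>. nat \<lfloor>\<Sum>i\<in>?K j. restrict (\<lambda>i. (case i of (j, k) \<Rightarrow> \<lambda>\<omega>. real (X j k \<omega>)) \<omega>) (?K j) i\<rfloor>)
      = T m"
    by (intro ext) (simp add: receiver_time_eq_sum sum.cartesian_product' flip: of_nat_sum)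
  finally show ?thesis .
qed

lemma measurable_T:
  "admissible m \<Longrightarrow> j \<in> {1..n} \<Longrightarrow> T m j \<in> measurable M (count_space UNIV)"
  using indep_T by (auto simp: indep_vars_def)

text \<open>Lowering \<open>m j\<close> by one removes exactly the current state \<open>k\<close>
  from the range of states, so the remaining time splits into the wait in \<open>k\<close> and a sum
  over later states, independent of it.\<close>

lemma T_first_state:
  assumes "admissible m" "j \<in> active n m"
  defines "k \<equiv> c0 j - m j + 1"
  defines "m' \<equiv> (\<lambda>i. m i - indicator {j} i)"
  shows "T m j = (\<lambda>\<omega>. X j k \<omega> + T m' j \<omega>)"
    and "indep_var (count_space UNIV) (X j k) (count_space UNIV) (T m' j)"
    and "k \<in> {1..c}" "j \<in> {1..n}"
proof -
  have j: "j \<in> {1..n}" "m j > 0"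
    using assms(2) by (auto simp: active_def)
  have split: "{c0 j - m j<..c0 j} = insert k {k<..c0 j}"
    using j by (auto simp: k_def)
  have m': "T m' j = (\<lambda>\<omega>. \<Sum>k\<in>{k<..c0 j}. X j k \<omega>)"
    by (simp add: receiver_time_eq_sum m'_def k_def algebra_simps fun_eq_iff)
  show "T m j = (\<lambda>\<omega>. X j k \<omega> + T m' j \<omega>)"
    unfolding m' by (simp add: receiver_time_eq_sum split fun_eq_iff)
  have sub: "insert k {k<..c0 j} \<subseteq> {1..c}"
    using states_subset[OF assms(1) j(1)] split by simp
  then show "k \<in> {1..c}" "j \<in> {1..n}"
    using j by auto
  have "indep_vars (\<lambda>_. count_space UNIV) (\<lambda>(j, k). X j k) (insert (j, k) ({j} \<times> {k<..c0 j}))"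
    using sub j(1) by (intro indep_vars_subset[OF indep_X]) auto
  then have "indep_var (count_space UNIV) ((\<lambda>(j, k). X j k) (j, k)) (count_space UNIV)
      (\<lambda>\<omega>. \<Sum>i\<in>{j} \<times> {k<..c0 j}. (\<lambda>(j, k). X j k) i \<omega>)"
    by (rule indep_var_sum_nat[rotated 2]) auto
  then show "indep_var (count_space UNIV) (X j k) (count_space UNIV) (T m' j)"
    by (simp add: m' sum.cartesian_product')
qed

section \<open>Distribution functions and the first-slot expansion\<close>

definition F :: "(nat \<Rightarrow> int) \<Rightarrow> nat \<Rightarrow> nat \<Rightarrow> real" where
  "F m j t = prob {\<omega>\<in>space M. T m j \<omega> \<le> t}"

text \<open>The distribution function of the maximum; this is established by independence in
  \<open>prob_max_time_le\<close>.\<close>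

definition G :: "(nat \<Rightarrow> int) \<Rightarrow> nat \<Rightarrow> real" where
  "G m t = (\<Prod>j\<in>{1..n}. F m j t)"

text \<open>Lets \<open>indicator S\<close> be replaced by \<open>indicator {j}\<close> for
  \<open>j\<close> in \<open>S\<close>, and dropped for \<open>j\<close> outside
  \<open>S\<close>.\<close>

lemma F_cong: "m j = m' j \<Longrightarrow> F m j t = F m' j t"
  by (simp add: F_def receiver_time_def)

lemma F_inactive: "j \<in> {1..n} - active n m \<Longrightarrow> F m j t = 1"
  by (force simp: F_def receiver_time_def active_def prob_space)

text \<open>An active receiver still waits for a geometric variable, which is almost surely at least
  1.\<close>

lemma F_0:
  assumes "admissible m" "j \<in> active n m"
  shows "F m j 0 = 0"
  using prob_geo_add_le_0[OF T_first_state(2)[OF assms] distr_X[OF T_first_state(4,3)[OF assms]]]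
  by (simp add: F_def T_first_state(1)[OF assms])

lemma F_Suc:
  assumes "admissible m" "j \<in> active n m"
  defines "k \<equiv> c0 j - m j + 1"
  shows "F m j (Suc t) = p j k * F (\<lambda>i. m i - indicator {j} i) j t + (1 - p j k) * F m j t"
  using prob_geo_add_le_Suc[OF T_first_state(2)[OF assms(1,2)]
      distr_X[OF T_first_state(4,3)[OF assms(1,2)]] p_range[OF T_first_state(4,3)[OF assms(1,2)]]]
  by (simp add: F_def T_first_state(1)[OF assms(1,2)] k_def)

lemma G_eq_active: "G m t = (\<Prod>j\<in>active n m. F m j t)"
  unfolding G_def
  by (rule prod.mono_neutral_right) (auto simp: F_inactive, auto simp: active_def)

lemma finite_active: "finite (active n m)"
  by (simp add: active_def)

lemma G_0:
  assumes "admissible m" "active n m \<noteq> {}"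
  shows "G m 0 = 0"
  using assms F_0 by (auto simp: G_eq_active finite_active)

definition weight :: "(nat \<Rightarrow> int) \<Rightarrow> nat set \<Rightarrow> real" where
  "weight m S = (\<Prod>j\<in>S. p j (c0 j - m j + 1)) * (\<Prod>j\<in>active n m - S. 1 - p j (c0 j - m j + 1))"

text \<open>Expanding the product of the factors \<open>p + (1 - p) = 1\<close> over the active
  receivers gives this sum.\<close>

lemma sum_weight: "(\<Sum>S\<in>Pow (active n m). weight m S) = 1"
  unfolding weight_def by (subst prod_add[symmetric]) (simp_all add: finite_active)

lemma G_Suc:
  assumes "admissible m"
  shows "G m (Suc t) = (\<Sum>S\<in>Pow (active n m). weight m S * G (\<lambda>j. m j - indicator S j) t)"
proof -
  let ?A = "active n m" and ?p = "\<lambda>j. p j (c0 j - m j + 1)"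
  have "G m (Suc t) =
      (\<Prod>j\<in>?A. ?p j * F (\<lambda>i. m i - indicator {j} i) j t + (1 - ?p j) * F m j t)"
    unfolding G_eq_active by (rule prod.cong[OF refl]) (rule F_Suc[OF assms])
  also have "\<dots> = (\<Sum>S\<in>Pow ?A. (\<Prod>j\<in>S. ?p j * F (\<lambda>i. m i - indicator {j} i) j t) *
      (\<Prod>j\<in>?A - S. (1 - ?p j) * F m j t))"
    by (rule prod_add[OF finite_active])
  also have "\<dots> = (\<Sum>S\<in>Pow ?A. weight m S * G (\<lambda>j. m j - indicator S j) t)"
  proof (rule sum.cong[OF refl])
    fix S assume "S \<in> Pow ?A"
    then have S: "S \<subseteq> ?A" "finite S"
      using finite_active finite_subset by auto
    let ?m' = "\<lambda>j. m j - indicator S j"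
    have "G ?m' t = (\<Prod>j\<in>?A. F ?m' j t)"
      unfolding G_def
    proof (rule prod.mono_neutral_right)
      \<comment> \<open>Receivers inactive for \<open>m\<close> stay inactive. A receiver in
        \<open>S\<close> with one success to go becomes inactive for \<open>?m'\<close>, but its
        factor may stay in the product over \<open>?A\<close>, being 1.\<close>
      show "\<forall>j\<in>{1..n} - ?A. F ?m' j t = 1"
        using S(1) by (auto intro!: F_inactive simp: active_def indicator_def split: split_of_bool_asm)
    qed (auto simp: active_def)
    also have "\<dots> = (\<Prod>j\<in>S. F ?m' j t) * (\<Prod>j\<in>?A - S. F ?m' j t)"
      using prod.subset_diff[OF S(1) finite_active] by (simp add: mult.commute)
    also have "(\<Prod>j\<in>S. F ?m' j t) = (\<Prod>j\<in>S. F (\<lambda>i. m i - indicator {j} i) j t)"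
      by (intro prod.cong F_cong) auto
    also have "(\<Prod>j\<in>?A - S. F ?m' j t) = (\<Prod>j\<in>?A - S. F m j t)"
      by (intro prod.cong F_cong) auto
    finally show "(\<Prod>j\<in>S. ?p j * F (\<lambda>i. m i - indicator {j} i) j t) *
        (\<Prod>j\<in>?A - S. (1 - ?p j) * F m j t) = weight m S * G ?m' t"
      by (simp add: weight_def prod.distrib)
  qed
  finally show ?thesis .
qed

section \<open>The maximum and its expectation\<close>

lemma max_time_le_iff: "max_time X n c0 m \<omega> \<le> t \<longleftrightarrow> (\<forall>j\<in>{1..n}. T m j \<omega> \<le> t)"
  unfolding max_time_def using n_pos by (subst Max_le_iff) auto

lemma measurable_max_time:
  assumes "admissible m"
  shows "max_time X n c0 m \<in> measurable M (count_space UNIV)"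
proof -
  have [measurable]: "T m j \<in> measurable M (count_space UNIV)" if "j \<in> {1..n}" for j
    using measurable_T[OF assms that] .
  \<comment> \<open>The values are countable, so preimages of singletons suffice; each is a finite
    combination of events of the \<open>T m j\<close>.\<close>
  have "max_time X n c0 m \<omega> = i \<longleftrightarrow> (\<exists>j\<in>{1..n}. T m j \<omega> = i) \<and> (\<forall>j\<in>{1..n}. T m j \<omega> \<le> i)" for \<omega> i
    unfolding max_time_def using n_pos by (subst Max_eq_iff) auto
  then have "max_time X n c0 m -` {i} \<inter> space M =
      {\<omega>\<in>space M. (\<exists>j\<in>{1..n}. T m j \<omega> = i) \<and> (\<forall>j\<in>{1..n}. T m j \<omega> \<le> i)}" for i
    by auto
  also have "\<dots> i \<in> sets M" for i
    by measurable
  finally show ?thesis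
    by (simp add: measurable_count_space_eq2_countable)
qed

lemma prob_max_time_le:
  assumes "admissible m"
  shows "prob {\<omega>\<in>space M. max_time X n c0 m \<omega> \<le> t} = G m t"
proof -
  have "{\<omega>\<in>space M. max_time X n c0 m \<omega> \<le> t} = (\<Inter>j\<in>{1..n}. T m j -` {..t} \<inter> space M)"
    using n_pos by (auto simp: max_time_le_iff)
  also have "prob \<dots> = (\<Prod>j\<in>{1..n}. prob (T m j -` {..t} \<inter> space M))"
    using n_pos by (intro indep_varsD_finite[OF indep_T[OF assms]]) auto
  also have "\<dots> = G m t"
    unfolding G_def F_def by (intro prod.cong arg_cong[where f = prob]) auto
  finally show ?thesis .
qed

lemma integrable_max_time:
  assumes "admissible m"
  shows "integrable M (\<lambda>\<omega>. real (max_time X n c0 m \<omega>))"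
proof (rule Bochner_Integration.integrable_bound)
  show "integrable M (\<lambda>\<omega>. \<Sum>j\<in>{1..n}. real (T m j \<omega>))"
    using integrable_T[OF assms] by auto
  \<comment> \<open>The sum of the receiver times is an integrable majorant of their
    maximum.\<close>
  have "max_time X n c0 m \<omega> \<le> (\<Sum>j\<in>{1..n}. T m j \<omega>)" for \<omega>
    unfolding max_time_le_iff by (auto intro!: member_le_sum)
  then have "real (max_time X n c0 m \<omega>) \<le> (\<Sum>j\<in>{1..n}. real (T m j \<omega>))" for \<omega>
    by (metis of_nat_le_iff of_nat_sum)
  then show "AE \<omega> in M. norm (real (max_time X n c0 m \<omega>)) \<le> norm (\<Sum>j\<in>{1..n}. real (T m j \<omega>))"
    by (simp add: sum_nonneg)
  note [measurable] = measurable_max_time[OF assms]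
  show "(\<lambda>\<omega>. real (max_time X n c0 m \<omega>)) \<in> borel_measurable M"
    by measurable
qed

lemma expected_time_sums:
  assumes "admissible m"
  shows "(\<lambda>t. 1 - G m t) sums expected_time M X n c0 m"
proof -
  note [measurable] = measurable_max_time[OF assms]
  have "prob {\<omega>\<in>space M. t < max_time X n c0 m \<omega>} = 1 - G m t" for t
    using prob_neg[of "\<lambda>\<omega>. max_time X n c0 m \<omega> \<le> t"]
    by (simp add: not_le prob_max_time_le[OF assms])
  then show ?thesis
    using expectation_nat_tail_sums[OF _ integrable_max_time[OF assms]]
    by (simp add: expected_time_def)
qed

text \<open>The term for \<open>S = {}\<close> contains the expectation at \<open>m\<close> itself,
  so this is an equation between finite numbers, obtained by adding convergent tail series and not
  by induction on \<open>m\<close>.\<close>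

lemma expected_time_recurrence:
  assumes "admissible m" "active n m \<noteq> {}"
  shows "expected_time M X n c0 m =
    1 + (\<Sum>S\<in>Pow (active n m). weight m S * expected_time M X n c0 (\<lambda>j. m j - indicator S j))"
    (is "_ = 1 + ?R")
proof -
  have "(\<lambda>t. \<Sum>S\<in>Pow (active n m). weight m S * (1 - G (\<lambda>j. m j - indicator S j) t)) sums ?R"
    using assms(1)
    by (intro sums_sum sums_mult expected_time_sums) (auto simp: indicator_def)
  also have "(\<lambda>t. \<Sum>S\<in>Pow (active n m). weight m S * (1 - G (\<lambda>j. m j - indicator S j) t)) =
      (\<lambda>t. 1 - G m (Suc t))"
    by (simp add: G_Suc[OF assms(1)] right_diff_distrib sum_subtractf sum_weight)
  \<comment> \<open>The series found so far starts at the tail with index 1. Prepending index 0 adds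
    \<open>1 - G m 0\<close>, which is 1 since some receiver is active: this is the slot in
    progress.\<close>
  finally have "(\<lambda>t. 1 - G m t) sums (?R + (1 - G m 0))"
    by (rule sums_Suc)
  then show ?thesis
    using sums_unique2[OF expected_time_sums[OF assms(1)]] G_0[OF assms] by simp
qed

text \<open>All receiver times are empty sums, and \<open>n_pos\<close> makes the maximum range over
  a nonempty set of zeros.\<close>

lemma expected_time_zero: "expected_time M X n c0 (\<lambda>_. 0) = 0"
  using n_pos by (simp add: expected_time_def max_time_def receiver_time_def image_constant_conv)

end

section \<open>The two reception models\<close>

lemma state_dep_prob_range:
  assumes "2 \<le> d" "k \<le> c" "0 < q j" "q j < 1"
  shows "state_dep_prob d c q j k \<in> {0<..1}"
proof -
  \<comment> \<open>For \<open>k \<le> c\<close> the exponent is at most -1, so with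
    \<open>d \<ge> 2\<close> the power is at most \<open>1/d\<close> and the factor in front of
    \<open>q j\<close> stays positive.\<close>
  have "real d powi (k - 1 - c) \<le> real d powi (-1)"
    using assms by (intro power_int_increasing) auto
  also have "\<dots> < 1"
    using assms by (simp add: power_int_minus field_simps)
  finally have "0 < 1 - real d powi (k - 1 - c)" "1 - real d powi (k - 1 - c) \<le> 1"
    by (auto simp: zero_le_power_int)
  then show ?thesis
    using assms by (auto simp: state_dep_prob_def mult_le_one)
qed

theorem corollary3:
  fixes M :: "'a measure" and X :: "nat \<Rightarrow> int \<Rightarrow> 'a \<Rightarrow> nat"
    and n :: nat and c :: int and c0 :: "nat \<Rightarrow> int" and q :: "nat \<Rightarrow> real"
  assumes "prob_space M"
    and "1 \<le> n" and "1 \<le> c"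
    and "\<And>j. j \<in> {1..n} \<Longrightarrow> 0 \<le> c0 j \<and> c0 j \<le> c"
    and "\<And>j. j \<in> {1..n} \<Longrightarrow> 0 < q j \<and> q j < 1"
  shows
    "(\<forall>d::nat. 2 \<le> d \<longrightarrow> indep_geometric M X n c (state_dep_prob d c q) \<longrightarrow>
        (\<forall>m :: nat \<Rightarrow> int. (\<forall>j\<in>{1..n}. m j \<le> c0 j) \<longrightarrow> active n m \<noteq> {} \<longrightarrow>
           expected_time M X n c0 m =
             1 + (\<Sum>S\<in>Pow (active n m).
                    (\<Prod>j\<in>S. state_dep_prob d c q j (c0 j - m j + 1)) *
                    (\<Prod>j\<in>active n m - S. 1 - state_dep_prob d c q j (c0 j - m j + 1)) *
                    expected_time M X n c0 (\<lambda>j. m j - indicator S j))) \<and>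
        expected_time M X n c0 (\<lambda>_. 0) = 0)
     \<and>
     (indep_geometric M X n c (\<lambda>j k. q j) \<longrightarrow>
        (\<forall>m :: nat \<Rightarrow> int. (\<forall>j\<in>{1..n}. m j \<le> c0 j) \<longrightarrow> active n m \<noteq> {} \<longrightarrow>
           expected_time M X n c0 m =
             1 + (\<Sum>S\<in>Pow (active n m).
                    (\<Prod>j\<in>S. q j) *
                    (\<Prod>j\<in>active n m - S. 1 - q j) *
                    expected_time M X n c0 (\<lambda>j. m j - indicator S j))) \<and>
        expected_time M X n c0 (\<lambda>_. 0) = 0)"
proof (intro conjI allI impI)
  fix d :: nat
  assume d: "2 \<le> d" and geo: "indep_geometric M X n c (state_dep_prob d c q)"
  interpret prob_space M by fact
  interpret receivers M X n c c0 "state_dep_prob d c q"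
    by unfold_locales (use assms geo d state_dep_prob_range in auto)
  show "expected_time M X n c0 (\<lambda>_. 0) = 0"
    by (rule expected_time_zero)
  show "expected_time M X n c0 m =
      1 + (\<Sum>S\<in>Pow (active n m).
        (\<Prod>j\<in>S. state_dep_prob d c q j (c0 j - m j + 1)) *
        (\<Prod>j\<in>active n m - S. 1 - state_dep_prob d c q j (c0 j - m j + 1)) *
        expected_time M X n c0 (\<lambda>j. m j - indicator S j))"
    if "\<forall>j\<in>{1..n}. m j \<le> c0 j" "active n m \<noteq> {}" for m
    using expected_time_recurrence[OF that] unfolding weight_def .
next
  assume geo: "indep_geometric M X n c (\<lambda>j k. q j)"
  interpret prob_space M by fact
  interpret receivers M X n c c0 "\<lambda>j k. q j"
    by unfold_locales (use assms geo in \<open>auto simp: less_imp_le\<close>)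
  show "expected_time M X n c0 (\<lambda>_. 0) = 0"
    by (rule expected_time_zero)
  show "expected_time M X n c0 m =
      1 + (\<Sum>S\<in>Pow (active n m). (\<Prod>j\<in>S. q j) * (\<Prod>j\<in>active n m - S. 1 - q j) *
        expected_time M X n c0 (\<lambda>j. m j - indicator S j))"
    if "\<forall>j\<in>{1..n}. m j \<le> c0 j" "active n m \<noteq> {}" for m
    using expected_time_recurrence[OF that] unfolding weight_def .
qed

end
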